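(* Let $\Omega\subset\mathbb{R}^n$ be an open set. Consider a mesh $\mathcal{K}$ of $\Omega$ of size $\delta=\sup_{K\in\mathcal{K}}\mathrm{diam}\,K$ and a family $\{(x_K,m_K,P_K)\}_{K\in\mathcal{K}}\subset\mathbb{R}^n\times\mathbb{R}_+\times G_{d,n}$ such that $x_K\in K$ for all $K\in\mathcal{K}$. Define the volumetric varifold $V^{vol}_{\mathcal{K}}$ and the point cloud varifold $V^{pt}_{\mathcal{K}}$ by \[ V^{vol}_{\mathcal{K}}=\sum_{K\in\mathcal{K}}\frac{m_K}{|K|}\mathcal{L}^n_{|K}\otimes\delta_{P_K}\qquad\text{and}\qquad V^{pt}_{\mathcal{K}}=\sum_{K\in\mathcal{K}}m_K\,\delta_{x_K}\otimes\delta_{P_K}. \] Then, for any open set $U\subset\Omega$, \[ \Delta^{1,1}_U(V^{vol}_{\mathcal{K}},V^{pt}_{\mathcal{K}})\le\delta\,\min\left(\|V^{vol}_{\mathcal{K}}\|(U^\delta),\|V^{pt}_{\mathcal{K}}\|(U^\delta)\right). \]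
   Context: Fix integers $1\le d<n$. $G_{d,n}$ is the Grassmannian of $d$-dimensional linear subspaces of $\mathbb{R}^n$; a subspace $S$ is identified with the orthogonal projection onto it, with metric $\|S-P\|$ (operator norm). A $d$-varifold in $\Omega$ is a non-negative Radon measure $V$ on $\Omega\times G_{d,n}$; its mass is $\|V\|(B)=V(B\times G_{d,n})$. A mesh of $\Omega$ is a countable partition $\mathcal{K}$ of $\Omega$ into pairwise disjoint (Borel) cells, of positive Lebesgue measure $|K|=\mathcal{L}^n(K)$, such that only finitely many cells meet any given bounded set. For $U\subset\Omega$ open, $\Delta^{1,1}_U(V,W)$ is the supremum of $\left|\int\varphi\,dV-\int\varphi\,dW\right|$ over all $1$-Lipschitz $\varphi:\Omega\times G_{d,n}\to\mathbb{R}$ with $\|\varphi\|_\infty\le1$ and $\mathrm{spt}\,\varphi\subset U\times G_{d,n}$, where $\Omega\times G_{d,n}$ carries the metric $|x-y|+\|S-T\|$. $U^\delta=\bigcup_{x\in U}B_\delta(x)$ (masses of $U^\delta$ are understood as masses of $U^\delta\cap\Omega$). *)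

theory Defs
  imports "HOL-Analysis.Analysis" "HOL-Probability.Giry_Monad"
begin

section \<open>The Grassmannian as a set of orthogonal projections\<close>

text \<open>
  A subspace is identified with the orthogonal projection onto it. The distance of
  \<^typ>\<open>'a \<Rightarrow>\<^sub>L 'b\<close> is the operator norm of the difference.
\<close>

definition orth_proj_onto ::
    "(real^'n) set \<Rightarrow> ((real^'n) \<Rightarrow>\<^sub>L (real^'n)) \<Rightarrow> bool" where
  "orth_proj_onto S P \<longleftrightarrow>
     (\<forall>v. blinfun_apply P v \<in> S \<and> (\<forall>w\<in>S. orthogonal (v - blinfun_apply P v) w))"

definition grassmannian :: "nat \<Rightarrow> ((real^'n) \<Rightarrow>\<^sub>L (real^'n)) set" where
  "grassmannian d = {P. \<exists>S. subspace S \<and> dim S = d \<and> orth_proj_onto S P}"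

section \<open>Meshes\<close>

definition mesh :: "(real^'n) set \<Rightarrow> (real^'n) set set \<Rightarrow> bool" where
  "mesh \<Omega> \<K> \<longleftrightarrow>
     countable \<K> \<and> partition_on \<Omega> \<K> \<and>
     (\<forall>K\<in>\<K>. K \<in> sets borel \<and> 0 < emeasure lborel K) \<and>
     (\<forall>B. bounded B \<longrightarrow> finite {K\<in>\<K>. K \<inter> B \<noteq> {}})"

text \<open>
  Diameters are taken in the extended half-line, since \<^const>\<open>diameter\<close> and real suprema
  are meaningless for unbounded sets.
\<close>

definition ediam :: "'a::metric_space set \<Rightarrow> ennreal" where
  "ediam K = (SUP x\<in>K. SUP y\<in>K. ennreal (dist x y))"

definition mesh_size :: "'a::metric_space set set \<Rightarrow> ennreal" where
  "mesh_size \<K> = (SUP K\<in>\<K>. ediam K)"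

text \<open>The union of the open balls of radius \<open>\<delta>\<close> around the points of \<open>U\<close>; the radius may be infinite.\<close>

definition enlarge :: "'a::metric_space set \<Rightarrow> ennreal \<Rightarrow> 'a set" where
  "enlarge U \<delta> = (\<Union>x\<in>U. {y. ennreal (dist x y) < \<delta>})"

section \<open>Varifolds\<close>

definition varifold_space ::
    "nat \<Rightarrow> (real^'n) set \<Rightarrow> ((real^'n) \<times> ((real^'n) \<Rightarrow>\<^sub>L (real^'n))) measure" where
  "varifold_space d \<Omega> = restrict_space borel (\<Omega> \<times> grassmannian d)"

text \<open>
  Borel measures that are finite on compact sets; on the locally compact separable metric
  space \<open>\<Omega> \<times> G\<close> these are exactly the Radon measures.
\<close>

definition varifold ::
    "nat \<Rightarrow> (real^'n) set \<Rightarrow> ((real^'n) \<times> ((real^'n) \<Rightarrow>\<^sub>L (real^'n))) measure \<Rightarrow> bool" where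
  "varifold d \<Omega> V \<longleftrightarrow>
     sets V = sets (varifold_space d \<Omega>) \<and>
     (\<forall>C. compact C \<and> C \<subseteq> \<Omega> \<times> grassmannian d \<longrightarrow> emeasure V C < \<infinity>)"

definition mass ::
    "nat \<Rightarrow> ((real^'n) \<times> ((real^'n) \<Rightarrow>\<^sub>L (real^'n))) measure \<Rightarrow> (real^'n) set \<Rightarrow> ennreal" where
  "mass d V B = emeasure V (B \<times> grassmannian d)"

text \<open>Sum of a family of measures, as a measure on the measurable space \<open>N\<close>.\<close>

definition sum_measure :: "'a measure \<Rightarrow> 'i set \<Rightarrow> ('i \<Rightarrow> 'a measure) \<Rightarrow> 'a measure" where
  "sum_measure N I M =
     measure_of (space N) (sets N) (\<lambda>A. \<integral>\<^sup>+i. emeasure (M i) A \<partial>count_space I)"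

definition volumetric_varifold ::
    "nat \<Rightarrow> (real^'n) set \<Rightarrow> (real^'n) set set \<Rightarrow> ((real^'n) set \<Rightarrow> real) \<Rightarrow>
     ((real^'n) set \<Rightarrow> ((real^'n) \<Rightarrow>\<^sub>L (real^'n))) \<Rightarrow>
     ((real^'n) \<times> ((real^'n) \<Rightarrow>\<^sub>L (real^'n))) measure" where
  "volumetric_varifold d \<Omega> \<K> m P =
     sum_measure (varifold_space d \<Omega>) \<K>
       (\<lambda>K. scale_measure (ennreal (m K / measure lborel K))
              (density lborel (indicator K) \<Otimes>\<^sub>M return borel (P K)))"

definition point_cloud_varifold ::
    "nat \<Rightarrow> (real^'n) set \<Rightarrow> (real^'n) set set \<Rightarrow> ((real^'n) set \<Rightarrow> real^'n) \<Rightarrow>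
     ((real^'n) set \<Rightarrow> real) \<Rightarrow> ((real^'n) set \<Rightarrow> ((real^'n) \<Rightarrow>\<^sub>L (real^'n))) \<Rightarrow>
     ((real^'n) \<times> ((real^'n) \<Rightarrow>\<^sub>L (real^'n))) measure" where
  "point_cloud_varifold d \<Omega> \<K> x m P =
     sum_measure (varifold_space d \<Omega>) \<K>
       (\<lambda>K. scale_measure (ennreal (m K)) (return borel (x K) \<Otimes>\<^sub>M return borel (P K)))"

section \<open>Well-definedness\<close>

text \<open>
  The sums above are genuine measures with the expected values and are varifolds. Second
  countability of the operator space is what makes the product of the Borel algebras the
  Borel algebra of the product.
\<close>

lemma heine_borel_countable_basis:
  "\<exists>B::'a::heine_borel set set. countable B \<and> open = generate_topology B"
proof -
  obtain a :: 'a where True by simp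
  have "\<exists>k. finite k \<and> cball a (real n) \<subseteq> (\<Union>x\<in>k. ball x (1 / real (Suc j)))" for n j
  proof -
    have "compact (cball a (real n))" by simp
    then show ?thesis
      unfolding compact_eq_totally_bounded by auto
  qed
  then obtain k where k: "\<And>n j. finite (k n j)"
      "\<And>n j. cball a (real n) \<subseteq> (\<Union>x\<in>k n j. ball x (1 / real (Suc j)))" by metis
  define B where "B = (\<Union>n j. (\<lambda>x. ball x (1 / real (Suc j))) ` k n j)"
  have "countable B" unfolding B_def by (intro countable_UN countable_image) (auto simp: k countable_finite)
  moreover have "topological_basis B"
  proof (rule topological_basisI)
    fix b assume "b \<in> B" then show "open b" by (auto simp: B_def)
  next
    fix S and p :: 'a assume "open S" "p \<in> S"
    then obtain e where e: "e > 0" "ball p e \<subseteq> S" by (meson open_contains_ball)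
    obtain j where j: "1 / real (Suc j) < e / 2" using nat_approx_posE[of "e/2"] e by auto
    obtain n where n: "dist a p \<le> real n" using real_arch_simple by blast
    then have "p \<in> cball a (real n)" by simp
    then obtain q where q: "q \<in> k n j" "p \<in> ball q (1 / real (Suc j))" using k(2)[of n j] by blast
    have "ball q (1 / real (Suc j)) \<subseteq> ball p e"
    proof
      fix z assume "z \<in> ball q (1 / real (Suc j))"
      then have "dist q z < e/2" "dist q p < e/2" using q j by auto
      then show "z \<in> ball p e" using dist_triangle[of p z q] by (simp add: dist_commute)
    qed
    then show "\<exists>B'\<in>B. p \<in> B' \<and> B' \<subseteq> S" using q e unfolding B_def by blast
  qed
  ultimately show ?thesis using topological_basis_imp_subbasis by blast
qed

instance blinfun :: (euclidean_space, euclidean_space) second_countable_topology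
  by standard (rule heine_borel_countable_basis)

lemma orth_proj_onto_fixes:
  assumes "subspace S" "orth_proj_onto S P" "v \<in> S"
  shows "blinfun_apply P v = v"
proof -
  have "v - blinfun_apply P v \<in> S" using assms by (auto simp: orth_proj_onto_def subspace_diff)
  then have "orthogonal (v - blinfun_apply P v) (v - blinfun_apply P v)"
    using assms by (auto simp: orth_proj_onto_def)
  then show ?thesis by (simp add: orthogonal_self)
qed

lemma grassmannian_close_dim_le:
  assumes "subspace S" "orth_proj_onto S P" "subspace T" "orth_proj_onto T Q" "norm (P - Q) < 1"
  shows "dim S \<le> dim T"
proof -
  have inj: "inj_on (blinfun_apply Q) S"
  proof (rule inj_onI)
    fix v w assume vw: "v \<in> S" "w \<in> S" "blinfun_apply Q v = blinfun_apply Q w"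
    let ?u = "v - w"
    have "?u \<in> S" using assms vw by (simp add: subspace_diff)
    then have "blinfun_apply (P - Q) ?u = ?u"
      using orth_proj_onto_fixes[OF assms(1,2)] vw by (simp add: blinfun.bilinear_simps)
    then have "norm ?u \<le> norm (P - Q) * norm ?u" using norm_blinfun[of "P - Q" ?u] by simp
    then have "\<not> norm ?u > 0" using assms(5) by (auto simp: mult_le_cancel_right1 simp del: zero_less_norm_iff)
    then show "v = w" by simp
  qed
  have "dim S = dim (blinfun_apply Q ` S)"
    using inj assms(1) by (intro dim_image_eq[symmetric])
      (auto simp: blinfun.bounded_linear_right bounded_linear.linear span_eq_iff[THEN iffD2])
  also have "\<dots> \<le> dim T" using assms by (intro dim_subset) (auto simp: orth_proj_onto_def)
  finally show ?thesis .
qed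

lemma closed_grassmannian: "closed (grassmannian d :: ((real^'n) \<Rightarrow>\<^sub>L (real^'n)) set)"
  unfolding closed_sequential_limits
proof (intro allI impI; elim conjE)
  fix p and Q :: "(real^'n) \<Rightarrow>\<^sub>L (real^'n)"
  assume p: "\<forall>k. p k \<in> grassmannian d" and lim: "p \<longlonglongrightarrow> Q"
  then obtain S where S: "\<And>k. subspace (S k)" "\<And>k. dim (S k) = d" "\<And>k. orth_proj_onto (S k) (p k)"
    unfolding grassmannian_def by simp metis
  have lim1: "(\<lambda>k. blinfun_apply (p k) v) \<longlonglongrightarrow> blinfun_apply Q v" for v
    using lim by (intro tendsto_intros)
  let ?T = "range (blinfun_apply Q)"
  have T: "subspace ?T"
    by (intro linear_subspace_image) (auto simp: blinfun.bounded_linear_right bounded_linear.linear)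
  have "orthogonal (v - blinfun_apply Q v) (blinfun_apply Q u)" for u v
  proof -
    have "(\<lambda>k. (v - blinfun_apply (p k) v) \<bullet> blinfun_apply (p k) u) \<longlonglongrightarrow>
        (v - blinfun_apply Q v) \<bullet> blinfun_apply Q u"
      by (intro tendsto_intros lim1)
    moreover have "(\<lambda>k. (v - blinfun_apply (p k) v) \<bullet> blinfun_apply (p k) u) = (\<lambda>k. 0)"
      using S(3) by (auto simp: orth_proj_onto_def orthogonal_def)
    ultimately show ?thesis by (simp add: orthogonal_def LIMSEQ_const_iff)
  qed
  then have PT: "orth_proj_onto ?T Q" by (auto simp: orth_proj_onto_def)
  obtain k where k: "norm (p k - Q) < 1"
    using LIMSEQ_D[OF lim, of 1] by auto
  have "dim (S k) = dim ?T"
    using grassmannian_close_dim_le[OF S(1,3) T PT k] 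
      grassmannian_close_dim_le[OF T PT S(1,3), of k] k by (simp add: norm_minus_commute)
  then show "Q \<in> grassmannian d" using S(2) T PT by (auto simp: grassmannian_def)
qed

lemma emeasure_sum_measure:
  assumes "\<And>i. i \<in> I \<Longrightarrow> sets N \<subseteq> sets (M i)" and A: "A \<in> sets N"
  shows "emeasure (sum_measure N I M) A = (\<integral>\<^sup>+i. emeasure (M i) A \<partial>count_space I)"
  unfolding sum_measure_def
proof (rule emeasure_measure_of_sigma)
  show "sigma_algebra (space N) (sets N)" by (rule sets.sigma_algebra_axioms)
  show "positive (sets N) (\<lambda>A. \<integral>\<^sup>+i. emeasure (M i) A \<partial>count_space I)"
    by (simp add: positive_def)
  show "countably_additive (sets N) (\<lambda>A. \<integral>\<^sup>+i. emeasure (M i) A \<partial>count_space I)"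
  proof (rule countably_additiveI)
    fix F :: "nat \<Rightarrow> _" assume F: "range F \<subseteq> sets N" "disjoint_family F" "(\<Union>n. F n) \<in> sets N"
    have "(\<Sum>n. \<integral>\<^sup>+i. emeasure (M i) (F n) \<partial>count_space I) =
        (\<integral>\<^sup>+i. (\<Sum>n. emeasure (M i) (F n)) \<partial>count_space I)"
      by (rule nn_integral_suminf[symmetric]) simp
    also have "\<dots> = (\<integral>\<^sup>+i. emeasure (M i) (\<Union>n. F n) \<partial>count_space I)"
      using assms(1) F by (intro nn_integral_cong suminf_emeasure) auto
    finally show "(\<Sum>n. \<integral>\<^sup>+i. emeasure (M i) (F n) \<partial>count_space I) =
        (\<integral>\<^sup>+i. emeasure (M i) (\<Union>n. F n) \<partial>count_space I)" .
  qed
qed (fact A)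

lemma sets_varifold_space_subset:
  assumes "open \<Omega>"
  shows "sets (varifold_space d \<Omega>) \<subseteq> sets (borel \<Otimes>\<^sub>M borel)"
proof -
  have "\<Omega> \<times> grassmannian d \<in> sets borel"
    using assms by (intro borel_Times borel_open borel_closed closed_grassmannian)
  then show ?thesis unfolding varifold_space_def borel_prod by (auto simp: sets_restrict_space)
qed

lemma sets_varifolds [simp]:
  "sets (volumetric_varifold d \<Omega> \<K> m P) = sets (varifold_space d \<Omega>)"
  "sets (point_cloud_varifold d \<Omega> \<K> x m P) = sets (varifold_space d \<Omega>)"
  by (simp_all add: volumetric_varifold_def point_cloud_varifold_def sum_measure_def
      sets.sigma_sets_eq)

lemma emeasure_volumetric_varifold:
  assumes "open \<Omega>" "mesh \<Omega> \<K>" and A: "A \<in> sets (varifold_space d \<Omega>)"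
  shows "emeasure (volumetric_varifold d \<Omega> \<K> m P) A =
    (\<integral>\<^sup>+K. ennreal (m K / measure lborel K) * emeasure lborel {y \<in> K. (y, P K) \<in> A} \<partial>count_space \<K>)"
proof -
  have A': "A \<in> sets (borel \<Otimes>\<^sub>M borel)" using sets_varifold_space_subset[OF assms(1)] A by blast
  have "emeasure (density lborel (indicator K) \<Otimes>\<^sub>M return borel (P K)) A =
      emeasure lborel {y \<in> K. (y, P K) \<in> A}" if "K \<in> \<K>" for K
  proof -
    have K: "K \<in> sets borel" using that assms(2) by (auto simp: mesh_def)
    interpret R: prob_space "return borel (P K)" by (rule prob_space_return) simp
    have m: "{y. (y, P K) \<in> A} \<in> sets borel"
      using sets_Pair2[OF A', of "P K"] by (simp add: vimage_def)
    have "emeasure (density lborel (indicator K) \<Otimes>\<^sub>M return borel (P K)) A =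
      (\<integral>\<^sup>+y. emeasure (return borel (P K)) (Pair y -` A) \<partial>density lborel (indicator K))"
      using A' by (intro R.emeasure_pair_measure_alt) (simp cong: sets_pair_measure_cong)
    also have "\<dots> = (\<integral>\<^sup>+y. indicator {y. (y, P K) \<in> A} y \<partial>density lborel (indicator K))"
      using sets_Pair1[OF A'] by (intro nn_integral_cong) (simp add: indicator_def)
    also have "\<dots> = (\<integral>\<^sup>+y. indicator K y * indicator {y. (y, P K) \<in> A} y \<partial>lborel)"
      using K m by (intro nn_integral_density) auto
    also have "\<dots> = (\<integral>\<^sup>+y. indicator {y \<in> K. (y, P K) \<in> A} y \<partial>lborel)"
      by (intro nn_integral_cong) (auto simp: indicator_def)
    also have "\<dots> = emeasure lborel {y \<in> K. (y, P K) \<in> A}"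
      using K m by (intro nn_integral_indicator) (auto simp: Collect_conj_eq)
    finally show ?thesis .
  qed
  then show ?thesis unfolding volumetric_varifold_def
    using sets_varifold_space_subset[OF assms(1), of d] A
    by (subst emeasure_sum_measure)
       (auto intro!: nn_integral_cong cong: sets_pair_measure_cong)
qed

lemma emeasure_point_cloud_varifold:
  assumes "open \<Omega>" and A: "A \<in> sets (varifold_space d \<Omega>)"
  shows "emeasure (point_cloud_varifold d \<Omega> \<K> x m P) A =
    (\<integral>\<^sup>+K. ennreal (m K) * indicator A (x K, P K) \<partial>count_space \<K>)"
proof -
  have A': "A \<in> sets (borel \<Otimes>\<^sub>M borel)" using sets_varifold_space_subset[OF assms(1)] A by blast
  have "emeasure (return borel (x K) \<Otimes>\<^sub>M return borel (P K)) A = indicator A (x K, P K)" for K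
  proof -
    interpret R: prob_space "return borel (P K)" by (rule prob_space_return) simp
    have "emeasure (return borel (x K) \<Otimes>\<^sub>M return borel (P K)) A =
      (\<integral>\<^sup>+y. emeasure (return borel (P K)) (Pair y -` A) \<partial>return borel (x K))"
      using A' by (intro R.emeasure_pair_measure_alt) (simp cong: sets_pair_measure_cong)
    also have "\<dots> = emeasure (return borel (P K)) (Pair (x K) -` A)"
      using A' by (intro nn_integral_return) (auto intro!: R.measurable_emeasure_Pair simp: cong: sets_pair_measure_cong measurable_cong_sets)
    finally show ?thesis using sets_Pair1[OF A'] by (simp add: indicator_def)
  qed
  then show ?thesis unfolding point_cloud_varifold_def
    using sets_varifold_space_subset[OF assms(1), of d] A A'
    by (subst emeasure_sum_measure)
       (auto intro!: nn_integral_cong cong: sets_pair_measure_cong)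
qed


lemma
  assumes "open \<Omega>" "mesh \<Omega> \<K>" "\<And>K. K \<in> \<K> \<Longrightarrow> emeasure lborel K < \<infinity>"
    "\<And>K. K \<in> \<K> \<Longrightarrow> x K \<in> K" "\<And>K. K \<in> \<K> \<Longrightarrow> 0 \<le> m K"
  shows varifold_volumetric_varifold: "varifold d \<Omega> (volumetric_varifold d \<Omega> \<K> m P)" (is ?V)
    and varifold_point_cloud_varifold: "varifold d \<Omega> (point_cloud_varifold d \<Omega> \<K> x m P)" (is ?W)
proof -
  have *: "emeasure (volumetric_varifold d \<Omega> \<K> m P) C < \<infinity> \<and>
      emeasure (point_cloud_varifold d \<Omega> \<K> x m P) C < \<infinity>"
    if C: "compact C" "C \<subseteq> \<Omega> \<times> grassmannian d" for C
  proof -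
    define B where "B = fst ` C"
    define F where "F = {K \<in> \<K>. K \<inter> B \<noteq> {}}"
    have "bounded B" unfolding B_def
      by (intro compact_imp_bounded compact_continuous_image continuous_intros C)
    then have F: "finite F" "F \<subseteq> \<K>" using assms(2) by (auto simp: mesh_def F_def)
    have Cs: "C \<in> sets (varifold_space d \<Omega>)"
      using C by (auto simp: varifold_space_def sets_restrict_space intro!: borel_compact)
    have 1: "(\<integral>\<^sup>+K. f K \<partial>count_space \<K>) < \<infinity>"
      if "\<And>K. K \<in> F \<Longrightarrow> f K < \<infinity>" "\<And>K. K \<in> \<K> \<Longrightarrow> K \<notin> F \<Longrightarrow> f K = 0" for f :: "_ \<Rightarrow> ennreal"
    proof -
      have "(\<integral>\<^sup>+K. f K \<partial>count_space \<K>) = (\<Sum>K\<in>F. f K)"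
        using F that(2) by (intro nn_integral_count_space') auto
      then show ?thesis using F that(1) by (simp add: less_top)
    qed
    have "ennreal (m K / measure lborel K) * emeasure lborel {y \<in> K. (y, P K) \<in> C} < \<infinity>" if "K \<in> F" for K
    proof -
      have "emeasure lborel {y \<in> K. (y, P K) \<in> C} \<le> emeasure lborel K"
        using that F assms(2) by (intro emeasure_mono) (auto simp: mesh_def)
      also have "\<dots> < \<infinity>" using that F assms(3) by auto
      finally show ?thesis by (simp add: ennreal_mult_less_top)
    qed
    moreover have "emeasure lborel {y \<in> K. (y, P K) \<in> C} = 0" if "K \<in> \<K>" "K \<notin> F" for K
    proof -
      have "{y \<in> K. (y, P K) \<in> C} = {}" using that by (force simp: F_def B_def)
      then show ?thesis by (simp only: emeasure_empty)
    qed
    moreover have "(x K, P K) \<notin> C" if "K \<in> \<K>" "K \<notin> F" for K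
      using that assms(4)[OF that(1)] by (force simp: F_def B_def)
    ultimately show ?thesis
      unfolding emeasure_volumetric_varifold[OF assms(1,2) Cs] emeasure_point_cloud_varifold[OF assms(1) Cs]
      by (intro conjI 1) (auto simp: indicator_def)
  qed
  show ?V ?W using * by (auto simp: varifold_def)
qed

section \<open>The localized bounded Lipschitz distance\<close>

text \<open>
  The Lipschitz condition refers to the metric \<open>|x - y| + \<parallel>S - T\<parallel>\<close>, which is not the Euclidean
  product metric that \<^const>\<open>dist\<close> denotes on pairs. The support is the closure of the
  nonvanishing set relative to \<open>\<Omega> \<times> G\<close>.
\<close>

definition test_functions ::
    "nat \<Rightarrow> (real^'n) set \<Rightarrow> (real^'n) set \<Rightarrow>
     ((real^'n) \<times> ((real^'n) \<Rightarrow>\<^sub>L (real^'n)) \<Rightarrow> real) set" where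
  "test_functions d \<Omega> U =
     {\<phi>. (\<forall>x\<in>\<Omega>. \<forall>y\<in>\<Omega>. \<forall>S\<in>grassmannian d. \<forall>T\<in>grassmannian d.
             \<bar>\<phi> (x, S) - \<phi> (y, T)\<bar> \<le> dist x y + norm (S - T)) \<and>
          (\<forall>z\<in>\<Omega> \<times> grassmannian d. \<bar>\<phi> z\<bar> \<le> 1) \<and>
          (\<Omega> \<times> grassmannian d) \<inter> closure {z \<in> \<Omega> \<times> grassmannian d. \<phi> z \<noteq> 0}
             \<subseteq> U \<times> grassmannian d}"

text \<open>
  When one of the measures is infinite on \<open>U \<times> G\<close>, a test function need not be integrable.
  Such a function makes the distance infinite, so that the value \<open>0\<close> that
  \<^const>\<open>lebesgue_integral\<close> takes there by convention is never used.
\<close>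

definition integral_gap :: "'a measure \<Rightarrow> 'a measure \<Rightarrow> ('a \<Rightarrow> real) \<Rightarrow> ennreal" where
  "integral_gap V W \<phi> =
     (if integrable V \<phi> \<and> integrable W \<phi>
      then ennreal \<bar>(\<integral>z. \<phi> z \<partial>V) - (\<integral>z. \<phi> z \<partial>W)\<bar> else \<infinity>)"

definition bl_dist ::
    "nat \<Rightarrow> (real^'n) set \<Rightarrow> (real^'n) set \<Rightarrow>
     ((real^'n) \<times> ((real^'n) \<Rightarrow>\<^sub>L (real^'n))) measure \<Rightarrow>
     ((real^'n) \<times> ((real^'n) \<Rightarrow>\<^sub>L (real^'n))) measure \<Rightarrow> ennreal" where
  "bl_dist d \<Omega> U V W = (SUP \<phi>\<in>test_functions d \<Omega> U. integral_gap V W \<phi>)"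

end

theory Submission
  imports Defs
begin

text \<open>
  Both varifolds are images of a single measure on pairs \<open>(K, y)\<close> with \<open>y \<in> K\<close>, namely the one
  with density \<open>m\<^sub>K / |K|\<close>: the volumetric one under \<open>(K, y) \<mapsto> (y, P\<^sub>K)\<close>, the point cloud one under
  \<open>(K, y) \<mapsto> (x\<^sub>K, P\<^sub>K)\<close>. Under this coupling a test function changes by at most \<open>\<delta>\<close>, and only over
  cells meeting \<open>U\<close>. Since \<open>U\<close> is open, those cells lie in \<open>U\<^sup>\<delta>\<close>, so that their total weight
  is bounded by either of the two masses.
\<close>

section \<open>Diameters of cells and the enlargement of U\<close>

lemma ediam_upper: "a \<in> K \<Longrightarrow> b \<in> K \<Longrightarrow> ennreal (dist a b) \<le> ediam K"
  unfolding ediam_def by (meson SUP_upper2 order_refl)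

lemma ediam_le_mesh_size: "K \<in> \<K> \<Longrightarrow> ediam K \<le> mesh_size \<K>"
  unfolding mesh_size_def by (rule SUP_upper)

text \<open>A strict inequality between a continuous function and a constant, possibly infinite, is
  an open condition. Openness makes the masses of the enlargement those of measurable sets;
  elsewhere \<open>emeasure\<close> is 0 by convention.\<close>

lemma open_enlarge: "open (enlarge U \<delta>)"
  unfolding enlarge_def
  by (intro open_UN ballI open_Collect_less continuous_on_ennreal continuous_intros)

lemma mesh_cellD:
  assumes "mesh \<Omega> \<K>" "K \<in> \<K>"
  shows "K \<subseteq> \<Omega>" "K \<in> sets borel" "0 < emeasure lborel K"
  using assms by (auto simp: mesh_def partition_on_def)

text \<open>A set of positive Lebesgue measure is not a singleton. Positivity puts a point of U into
  the ball around itself and prevents a product of 0 and infinity in the final bound.\<close>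

lemma mesh_size_pos:
  fixes \<K> :: "(real^'n) set set"
  assumes "mesh \<Omega> \<K>" "K \<in> \<K>"
  shows "0 < mesh_size \<K>"
proof -
  note K = mesh_cellD[OF assms]
  have "K \<noteq> {}" using K(3) by auto
  then obtain a where a: "a \<in> K" by blast
  have "K \<noteq> {a}" using K(3) by auto
  then obtain b where b: "b \<in> K" "b \<noteq> a" using a by blast
  have "0 < ennreal (dist a b)" using b by simp
  also have "\<dots> \<le> mesh_size \<K>"
    using ediam_upper[OF a b(1)] ediam_le_mesh_size[OF assms(2)] by (rule order_trans)
  finally show ?thesis .
qed

text \<open>
  The balls forming \<open>U\<^sup>\<delta>\<close> are open, so a point at distance exactly \<open>\<delta>\<close> from \<open>u \<in> K \<inter> U\<close> is
  reached only after moving \<open>u\<close> slightly inside \<open>U\<close>.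
\<close>

lemma cell_subset_enlarge:
  fixes U :: "(real^'n) set"
  assumes "mesh \<Omega> \<K>" "K \<in> \<K>" "open U" "K \<inter> U \<noteq> {}"
  shows "K \<subseteq> enlarge U (mesh_size \<K>)"
proof
  fix z assume z: "z \<in> K"
  obtain u where u: "u \<in> K" "u \<in> U" using assms(4) by blast
  have le: "ennreal (dist u z) \<le> mesh_size \<K>"
    using ediam_upper[OF u(1) z] ediam_le_mesh_size[OF assms(2)] by (rule order_trans)
  show "z \<in> enlarge U (mesh_size \<K>)"
  proof (cases "u = z")
    case True
    then show ?thesis using u mesh_size_pos[OF assms(1,2)] by (force simp: enlarge_def)
  next
    case False
    obtain e where e: "e > 0" "ball u e \<subseteq> U" using assms(3) u(2) by (meson open_contains_ball)
    \<comment> \<open>The point u moves towards z: the bound 1/2 keeps it strictly short of z, the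
      other one keeps it inside the ball of radius e.\<close>
    define t where "t = min (1/2) (e / (2 * dist u z))"
    have t: "0 < t" "t < 1" "t * dist u z < e"
      using False e by (auto simp: t_def min_def field_simps)
    define v where "v = u + t *\<^sub>R (z - u)"
    have "dist u v = t * dist u z" using t by (simp add: v_def dist_norm norm_minus_commute)
    then have v: "v \<in> U" using e t by auto
    have "v - z = (1 - t) *\<^sub>R (u - z)" by (simp add: v_def algebra_simps)
    then have "dist v z = (1 - t) * dist u z" using t by (simp add: dist_norm)
    also have "\<dots> < dist u z" using t False by simp
    finally have "ennreal (dist v z) < ennreal (dist u z)" by (simp add: ennreal_less_iff)
    then show ?thesis using v le by (force simp: enlarge_def)
  qed
qed

section \<open>Measurability and support of test functions\<close>

lemma Times_grassmannian_in_sets: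
  assumes "open A" "A \<subseteq> \<Omega>" "open \<Omega>"
  shows "A \<times> grassmannian d \<in> sets (varifold_space d \<Omega>)"
proof -
  have "A \<times> grassmannian d \<in> sets borel"
    using assms by (intro borel_Times borel_open borel_closed closed_grassmannian)
  moreover have "\<Omega> \<times> grassmannian d \<in> sets borel"
    using assms by (intro borel_Times borel_open borel_closed closed_grassmannian)
  ultimately show ?thesis
    using assms(2) unfolding varifold_space_def by (subst sets_restrict_space_iff) auto
qed

lemma test_functions_measurable:
  fixes \<Omega> :: "(real^'n) set"
  assumes "\<phi> \<in> test_functions d \<Omega> U"
  shows "\<phi> \<in> borel_measurable (varifold_space d \<Omega>)"
  unfolding varifold_space_def
proof (rule borel_measurable_continuous_on_restrict)
  show "continuous_on (\<Omega> \<times> grassmannian d) \<phi>"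
  proof (rule continuous_onI)
    fix p :: "(real^'n) \<times> ((real^'n) \<Rightarrow>\<^sub>L (real^'n))" and e :: real
    assume p: "p \<in> \<Omega> \<times> grassmannian d" and e: "e > 0"
    have "dist (\<phi> q) (\<phi> p) \<le> e" if q: "q \<in> \<Omega> \<times> grassmannian d" "dist q p < e/2"
      for q :: "(real^'n) \<times> ((real^'n) \<Rightarrow>\<^sub>L (real^'n))"
    proof -
      have "dist (\<phi> q) (\<phi> p) \<le> dist (fst q) (fst p) + dist (snd q) (snd p)"
        using assms p q(1) unfolding test_functions_def
        by (cases p; cases q) (auto simp: dist_real_def dist_norm)
      \<comment> \<open>The sum metric of the Lipschitz condition is at most twice
        \<open>dist\<close> on pairs, whence the radius e/2.\<close>
      also have "\<dots> \<le> dist q p + dist q p" by (intro add_mono dist_fst_le dist_snd_le)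
      finally show ?thesis using q(2) by simp
    qed
    then show "\<exists>d'>0. \<forall>q\<in>\<Omega> \<times> grassmannian d. dist q p < d' \<longrightarrow> dist (\<phi> q) (\<phi> p) \<le> e"
      using e by (intro exI[of _ "e/2"]) auto
  qed
qed

lemma test_functions_nonzero:
  assumes "\<phi> \<in> test_functions d \<Omega> U" "z \<in> \<Omega> \<times> grassmannian d" "\<phi> z \<noteq> 0"
  shows "fst z \<in> U"
proof -
  have "z \<in> closure {z \<in> \<Omega> \<times> grassmannian d. \<phi> z \<noteq> 0}"
    using assms by (intro subsetD[OF closure_subset]) auto
  then show ?thesis using assms unfolding test_functions_def by fastforce
qed

section \<open>The measure on pairs of a cell and a point, and its two maps\<close>

definition cell_coupling ::
    "(real^'n) set set \<Rightarrow> ((real^'n) set \<Rightarrow> real) \<Rightarrow> ((real^'n) set \<times> (real^'n)) measure" where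
  "cell_coupling \<K> m = density (count_space \<K> \<Otimes>\<^sub>M lborel)
     (\<lambda>(K, y). ennreal (m K / measure lborel K) * indicator K y)"

text \<open>
  The coupling carries no mass at pairs with \<open>y \<notin> K\<close>; sending them to \<open>x\<^sub>K\<close> makes the map
  take values in \<open>\<Omega> \<times> G\<close> everywhere.
\<close>

definition cell_point ::
    "((real^'n) set \<Rightarrow> real^'n) \<Rightarrow> ((real^'n) set \<Rightarrow> ((real^'n) \<Rightarrow>\<^sub>L (real^'n))) \<Rightarrow>
     (real^'n) set \<times> (real^'n) \<Rightarrow> (real^'n) \<times> ((real^'n) \<Rightarrow>\<^sub>L (real^'n))" where
  "cell_point x P = (\<lambda>(K, y). (if y \<in> K then y else x K, P K))"

definition cell_center ::
    "((real^'n) set \<Rightarrow> real^'n) \<Rightarrow> ((real^'n) set \<Rightarrow> ((real^'n) \<Rightarrow>\<^sub>L (real^'n))) \<Rightarrow>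
     (real^'n) set \<times> (real^'n) \<Rightarrow> (real^'n) \<times> ((real^'n) \<Rightarrow>\<^sub>L (real^'n))" where
  "cell_center x P = (\<lambda>(K, y). (x K, P K))"

lemma sets_cell_coupling [measurable_cong]:
  "sets (cell_coupling \<K> m) = sets (count_space \<K> \<Otimes>\<^sub>M borel)"
  unfolding cell_coupling_def sets_density by (rule sets_pair_measure_cong) simp_all

lemma space_cell_coupling: "space (cell_coupling \<K> m) = \<K> \<times> UNIV"
  by (simp add: cell_coupling_def space_pair_measure)

section \<open>The two varifolds as images of the coupling\<close>

locale tagged_mesh =
  fixes d :: nat
    and \<Omega> :: "(real^'n) set"
    and \<K> :: "(real^'n) set set"
    and x :: "(real^'n) set \<Rightarrow> real^'n"
    and m :: "(real^'n) set \<Rightarrow> real"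
    and P :: "(real^'n) set \<Rightarrow> ((real^'n) \<Rightarrow>\<^sub>L (real^'n))"
  assumes open_domain: "open \<Omega>"
    and mesh: "mesh \<Omega> \<K>"
    and finite_cell: "\<And>K. K \<in> \<K> \<Longrightarrow> emeasure lborel K < \<infinity>"
    and tag: "\<And>K. K \<in> \<K> \<Longrightarrow> x K \<in> K"
    and weight_nonneg: "\<And>K. K \<in> \<K> \<Longrightarrow> 0 \<le> m K"
    and plane: "\<And>K. K \<in> \<K> \<Longrightarrow> P K \<in> grassmannian d"
begin

abbreviation "coupling \<equiv> cell_coupling \<K> m"
abbreviation "N \<equiv> varifold_space d \<Omega>"

lemma countable_mesh: "countable \<K>"
  using mesh by (simp add: mesh_def)

text \<open>The first factor is countable and discrete, so measurability can be checked one cell at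
  a time.\<close>

lemma measurable_couplingI:
  assumes "\<And>K. K \<in> \<K> \<Longrightarrow> (\<lambda>y. f (K, y)) \<in> measurable borel L"
  shows "f \<in> measurable (count_space \<K> \<Otimes>\<^sub>M borel) L"
  using countable_mesh assms by (rule measurable_pair_measure_countable1)

lemma measurable_cell_point: "cell_point x P \<in> measurable coupling N"
proof -
  have "cell_point x P \<in> measurable (count_space \<K> \<Otimes>\<^sub>M borel) borel"
  proof (rule measurable_couplingI)
    fix K assume "K \<in> \<K>"
    then have "K \<in> sets borel" by (rule mesh_cellD[OF mesh])
    then show "(\<lambda>y. cell_point x P (K, y)) \<in> measurable borel borel"
      by (simp add: cell_point_def borel_prod[symmetric])
  qed
  moreover have "cell_point x P \<in> space coupling \<rightarrow> \<Omega> \<times> grassmannian d"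
    using tag plane mesh_cellD(1)[OF mesh]
    by (fastforce simp: cell_point_def space_cell_coupling split: if_splits)
  ultimately show ?thesis
    unfolding varifold_space_def
    by (intro measurable_restrict_space2) (auto cong: measurable_cong_sets simp: sets_cell_coupling)
qed

lemma measurable_cell_center: "cell_center x P \<in> measurable coupling N"
proof -
  have "cell_center x P \<in> measurable (count_space \<K> \<Otimes>\<^sub>M borel) borel"
    by (rule measurable_couplingI) (simp add: cell_center_def)
  moreover have "cell_center x P \<in> space coupling \<rightarrow> \<Omega> \<times> grassmannian d"
    using tag plane mesh_cellD(1)[OF mesh] by (fastforce simp: cell_center_def space_cell_coupling)
  ultimately show ?thesis
    unfolding varifold_space_def
    by (intro measurable_restrict_space2) (auto cong: measurable_cong_sets simp: sets_cell_coupling)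
qed

text \<open>Tonelli's theorem slices the preimage of A by cells, and the indicator in the density
  confines each slice to its cell. The result has the shape of the explicit formulas for both
  varifolds.\<close>

lemma emeasure_distr_coupling:
  assumes g: "g \<in> measurable coupling N" and A: "A \<in> sets N"
  shows "emeasure (distr coupling N g) A =
    (\<integral>\<^sup>+K. ennreal (m K / measure lborel K) *
        emeasure lborel {y \<in> K. g (K, y) \<in> A} \<partial>count_space \<K>)"
proof -
  let ?w = "\<lambda>(K, y). ennreal (m K / measure lborel K) * indicator K y"
  have w: "?w \<in> borel_measurable (count_space \<K> \<Otimes>\<^sub>M lborel)"
  proof -
    have "?w \<in> borel_measurable (count_space \<K> \<Otimes>\<^sub>M borel)"
      using mesh_cellD(2)[OF mesh] by (intro measurable_couplingI) simp
    then show ?thesis by (simp cong: measurable_cong_sets sets_pair_measure_cong)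
  qed
  define B where "B = g -` A \<inter> space coupling"
  have B: "B \<in> sets (count_space \<K> \<Otimes>\<^sub>M lborel)"
    using measurable_sets[OF g A] by (simp add: B_def cell_coupling_def)
  have "emeasure (distr coupling N g) A = emeasure coupling B"
    using g A by (simp add: emeasure_distr B_def)
  also have "\<dots> = (\<integral>\<^sup>+p. ?w p * indicator B p \<partial>(count_space \<K> \<Otimes>\<^sub>M lborel))"
    unfolding cell_coupling_def using w B by (rule emeasure_density)
  also have "\<dots> = (\<integral>\<^sup>+K. \<integral>\<^sup>+y. ?w (K, y) * indicator B (K, y) \<partial>lborel \<partial>count_space \<K>)"
    using w B
    by (intro lborel.nn_integral_fst[symmetric] borel_measurable_times_ennreal borel_measurable_indicator)
  also have "\<dots> = (\<integral>\<^sup>+K. ennreal (m K / measure lborel K) *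
        emeasure lborel {y \<in> K. g (K, y) \<in> A} \<partial>count_space \<K>)"
  proof (intro nn_integral_cong)
    fix K assume "K \<in> space (count_space \<K>)"
    then have K: "K \<in> \<K>" by simp
    have eq: "{y \<in> K. g (K, y) \<in> A} = K \<inter> Pair K -` B"
      using K by (auto simp: B_def space_cell_coupling)
    have meas: "{y \<in> K. g (K, y) \<in> A} \<in> sets lborel"
      unfolding eq using mesh_cellD(2)[OF mesh K] sets_Pair1[OF B] by auto
    have "(\<integral>\<^sup>+y. ?w (K, y) * indicator B (K, y) \<partial>lborel) =
      (\<integral>\<^sup>+y. ennreal (m K / measure lborel K) * indicator {y \<in> K. g (K, y) \<in> A} y \<partial>lborel)"
      unfolding eq by (intro nn_integral_cong) (auto simp: indicator_def)
    then show "(\<integral>\<^sup>+y. ?w (K, y) * indicator B (K, y) \<partial>lborel) =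
      ennreal (m K / measure lborel K) * emeasure lborel {y \<in> K. g (K, y) \<in> A}"
      using meas by (simp add: nn_integral_cmult_indicator)
  qed
  finally show ?thesis .
qed

lemma volumetric_varifold_eq_distr:
  "volumetric_varifold d \<Omega> \<K> m P = distr coupling N (cell_point x P)"
proof (rule measure_eqI)
  fix A assume "A \<in> sets (volumetric_varifold d \<Omega> \<K> m P)"
  then have A: "A \<in> sets N" by simp
  have "{y \<in> K. cell_point x P (K, y) \<in> A} = {y \<in> K. (y, P K) \<in> A}" for K
    by (auto simp: cell_point_def)
  then show "emeasure (volumetric_varifold d \<Omega> \<K> m P) A =
      emeasure (distr coupling N (cell_point x P)) A"
    unfolding emeasure_volumetric_varifold[OF open_domain mesh A]
      emeasure_distr_coupling[OF measurable_cell_point A] by simp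
qed simp

lemma point_cloud_varifold_eq_distr:
  "point_cloud_varifold d \<Omega> \<K> x m P = distr coupling N (cell_center x P)"
proof (rule measure_eqI)
  fix A assume "A \<in> sets (point_cloud_varifold d \<Omega> \<K> x m P)"
  then have A: "A \<in> sets N" by simp
  show "emeasure (point_cloud_varifold d \<Omega> \<K> x m P) A =
      emeasure (distr coupling N (cell_center x P)) A"
    unfolding emeasure_point_cloud_varifold[OF open_domain A]
      emeasure_distr_coupling[OF measurable_cell_center A]
  proof (intro nn_integral_cong)
    fix K assume "K \<in> space (count_space \<K>)"
    then have K: "K \<in> \<K>" by simp
    \<comment> \<open>Finiteness matters here: on a cell of infinite volume \<open>measure\<close>
      would be 0, hence so would the quotient, and the weight m K would be lost.\<close>
    have fin: "emeasure lborel K = ennreal (measure lborel K)"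
      using finite_cell[OF K] by (simp add: emeasure_eq_ennreal_measure)
    then have pos: "0 < measure lborel K" using mesh_cellD(3)[OF mesh K] by simp
    have "ennreal (m K / measure lborel K) * emeasure lborel K = ennreal (m K)"
      unfolding fin using pos weight_nonneg[OF K] by (simp add: ennreal_mult[symmetric])
    \<comment> \<open>\<open>cell_center\<close> is constant on the slice over K, so the set on the
      right is either all of K or empty.\<close>
    then show "ennreal (m K) * indicator A (x K, P K) = ennreal (m K / measure lborel K) *
        emeasure lborel {y \<in> K. cell_center x P (K, y) \<in> A}"
      by (simp add: cell_center_def indicator_def)
  qed
qed simp

section \<open>The estimate for a single test function\<close>

lemma integral_gap_le:
  assumes \<phi>: "\<phi> \<in> test_functions d \<Omega> U" and U: "open U" "U \<subseteq> \<Omega>"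
  shows "integral_gap (volumetric_varifold d \<Omega> \<K> m P) (point_cloud_varifold d \<Omega> \<K> x m P) \<phi>
    \<le> mesh_size \<K> *
        min (mass d (volumetric_varifold d \<Omega> \<K> m P) (enlarge U (mesh_size \<K>) \<inter> \<Omega>))
            (mass d (point_cloud_varifold d \<Omega> \<K> x m P) (enlarge U (mesh_size \<K>) \<inter> \<Omega>))"
    (is "?gap \<le> ?\<delta> * min ?mV ?mW")
proof -
  define E where "E = {K \<in> \<K>. K \<inter> U \<noteq> {}} \<times> (UNIV :: (real^'n) set)"
  have E: "E \<in> sets coupling"
    unfolding sets_cell_coupling E_def by (rule pair_measureI) auto
  have in_cell: "fst (g p) \<in> fst p \<and> g p \<in> \<Omega> \<times> grassmannian d"
    if "g = cell_point x P \<or> g = cell_center x P" "p \<in> space coupling" for g p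
    using that tag plane mesh_cellD(1)[OF mesh]
    by (fastforce simp: cell_point_def cell_center_def space_cell_coupling)
  \<comment> \<open>Both maps send a pair into its own cell, and a cell meeting U lies in the
    enlargement. Hence E is contained in either preimage.\<close>
  have mass_ge: "emeasure coupling E \<le> mass d (distr coupling N g) (enlarge U ?\<delta> \<inter> \<Omega>)"
    if g: "g = cell_point x P \<or> g = cell_center x P" for g
  proof -
    let ?A = "(enlarge U ?\<delta> \<inter> \<Omega>) \<times> grassmannian d"
    have gm: "g \<in> measurable coupling N"
      using g measurable_cell_point measurable_cell_center by blast
    have A: "?A \<in> sets N"
      using open_domain by (intro Times_grassmannian_in_sets open_Int open_enlarge) auto
    have "E \<subseteq> g -` ?A \<inter> space coupling"
    proof
      fix p assume p: "p \<in> E"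
      then have ps: "p \<in> space coupling" by (auto simp: E_def space_cell_coupling)
      have "fst p \<subseteq> enlarge U ?\<delta>"
        using p U by (intro cell_subset_enlarge[OF mesh]) (auto simp: E_def)
      then show "p \<in> g -` ?A \<inter> space coupling"
        using in_cell[OF g ps] ps by (cases "g p") auto
    qed
    then have "emeasure coupling E \<le> emeasure coupling (g -` ?A \<inter> space coupling)"
      using measurable_sets[OF gm A] by (intro emeasure_mono)
    then show ?thesis using gm A by (simp add: mass_def emeasure_distr)
  qed
  have E_le: "emeasure coupling E \<le> min ?mV ?mW"
    using mass_ge unfolding volumetric_varifold_eq_distr point_cloud_varifold_eq_distr by simp
  show ?thesis
  proof (cases "emeasure coupling E = \<infinity>")
    \<comment> \<open>The right-hand side is infinite, whatever the gap is. This needs \<delta> > 0,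
      since 0 times infinity is 0 in \<open>ennreal\<close>; a point of E provides the cell that
      gives it.\<close>
    case True
    then have "E \<noteq> {}" by auto
    then have "0 < ?\<delta>" using mesh_size_pos[OF mesh] by (auto simp: E_def)
    moreover have "min ?mV ?mW = \<infinity>" using E_le True by (simp add: top_unique)
    ultimately show ?thesis by (simp add: ennreal_mult_top)
  next
    case False
    \<comment> \<open>Where the test function is nonzero, the image point lies in U and in its cell,
      so that cell meets U.\<close>
    have supp: "norm (\<phi> (g p)) \<le> indicator E p"
      if g: "g = cell_point x P \<or> g = cell_center x P" and p: "p \<in> space coupling" for g p
    proof (cases "\<phi> (g p) = 0")
      case False
      then have "fst (g p) \<in> U"
        using in_cell[OF g p] by (intro test_functions_nonzero[OF \<phi>]) auto
      then have "p \<in> E" using in_cell[OF g p] p by (cases p) (auto simp: E_def space_cell_coupling)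
      moreover have "\<bar>\<phi> (g p)\<bar> \<le> 1" using \<phi> in_cell[OF g p] by (auto simp: test_functions_def)
      ultimately show ?thesis by simp
    qed simp
    \<comment> \<open>The bound by the indicator of E, a set of finite measure in this case, gives
      integrability. So \<open>integral_gap\<close> takes its finite branch below.\<close>
    have int: "integrable coupling (\<lambda>p. \<phi> (g p))"
      and meas: "(\<lambda>p. \<phi> (g p)) \<in> borel_measurable coupling"
      and gm: "g \<in> measurable coupling N"
      if g: "g = cell_point x P \<or> g = cell_center x P" for g
    proof -
      show gm: "g \<in> measurable coupling N"
        using g measurable_cell_point measurable_cell_center by blast
      show meas: "(\<lambda>p. \<phi> (g p)) \<in> borel_measurable coupling"
        using gm test_functions_measurable[OF \<phi>] by (rule measurable_compose)
      show "integrable coupling (\<lambda>p. \<phi> (g p))"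
      proof (rule Bochner_Integration.integrable_bound)
        show "integrable coupling (indicator E :: _ \<Rightarrow> real)"
          using E False by (simp add: less_top)
        show "AE p in coupling. norm (\<phi> (g p)) \<le> norm (indicator E p :: real)"
          using supp[OF g] by (intro AE_I2) (simp add: indicator_def)
      qed (rule meas)
    qed
    let ?f = "\<lambda>p. \<phi> (cell_point x P p) - \<phi> (cell_center x P p)"
    \<comment> \<open>Both images of a pair carry the same plane, so the Lipschitz bound leaves only
      the distance between two points of one cell. Outside E both values vanish by
      \<open>supp\<close>.\<close>
    have dif: "ennreal (norm (?f p)) \<le> ?\<delta> * indicator E p" if p: "p \<in> space coupling" for p
    proof (cases "p \<in> E")
      case True
      obtain K y where p': "p = (K, y)" "K \<in> \<K>" using p by (auto simp: space_cell_coupling)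
      have c: "fst (cell_point x P p) \<in> K" "x K \<in> K"
        using in_cell[of "cell_point x P" p] p p' tag by auto
      have "\<bar>\<phi> (fst (cell_point x P p), P K) - \<phi> (x K, P K)\<bar> \<le>
          dist (fst (cell_point x P p)) (x K) + norm (P K - P K)"
        using \<phi> c plane[OF p'(2)] mesh_cellD(1)[OF mesh p'(2)] unfolding test_functions_def by blast
      then have "norm (?f p) \<le> dist (fst (cell_point x P p)) (x K)"
        by (simp add: p' cell_point_def cell_center_def)
      then have "ennreal (norm (?f p)) \<le> ennreal (dist (fst (cell_point x P p)) (x K))"
        by (rule ennreal_leI)
      also have "\<dots> \<le> ?\<delta>"
        using ediam_upper[OF c] ediam_le_mesh_size[OF p'(2)] by (rule order_trans)
      finally show ?thesis using True by simp
    next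
      case False
      then show ?thesis
        using supp[of "cell_point x P" p] supp[of "cell_center x P" p] p by simp
    qed
    have "?gap = ennreal \<bar>(\<integral>p. \<phi> (cell_point x P p) \<partial>coupling) -
        (\<integral>p. \<phi> (cell_center x P p) \<partial>coupling)\<bar>"
      unfolding volumetric_varifold_eq_distr point_cloud_varifold_eq_distr integral_gap_def
      using int gm test_functions_measurable[OF \<phi>]
      by (simp add: integrable_distr_eq integral_distr)
    also have "\<dots> = ennreal (norm (\<integral>p. ?f p \<partial>coupling))"
      using int by simp
    also have "\<dots> \<le> (\<integral>\<^sup>+p. ennreal (norm (?f p)) \<partial>coupling)"
      using int by (intro integral_norm_bound_ennreal) simp
    also have "\<dots> \<le> (\<integral>\<^sup>+p. ?\<delta> * indicator E p \<partial>coupling)"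
      using dif by (intro nn_integral_mono)
    also have "\<dots> = ?\<delta> * emeasure coupling E"
      using E by (simp add: nn_integral_cmult_indicator)
    also have "\<dots> \<le> ?\<delta> * min ?mV ?mW"
      using E_le by (rule mult_left_mono) simp
    finally show ?thesis .
  qed
qed

end

theorem proposition2p13:
  fixes d :: nat
    and \<Omega> U :: "(real^'n) set"
    and \<K> :: "(real^'n) set set"
    and x :: "(real^'n) set \<Rightarrow> real^'n"
    and m :: "(real^'n) set \<Rightarrow> real"
    and P :: "(real^'n) set \<Rightarrow> ((real^'n) \<Rightarrow>\<^sub>L (real^'n))"
  assumes "1 \<le> d" and "d < CARD('n)"
    and "open \<Omega>"
    and "mesh \<Omega> \<K>"
    and "\<And>K. K \<in> \<K> \<Longrightarrow> emeasure lborel K < \<infinity>"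
    and "\<And>K. K \<in> \<K> \<Longrightarrow> x K \<in> K"
    and "\<And>K. K \<in> \<K> \<Longrightarrow> 0 \<le> m K"
    and "\<And>K. K \<in> \<K> \<Longrightarrow> P K \<in> grassmannian d"
    and "open U" and "U \<subseteq> \<Omega>"
  shows "bl_dist d \<Omega> U (volumetric_varifold d \<Omega> \<K> m P) (point_cloud_varifold d \<Omega> \<K> x m P)
    \<le> mesh_size \<K> *
        min (mass d (volumetric_varifold d \<Omega> \<K> m P) (enlarge U (mesh_size \<K>) \<inter> \<Omega>))
            (mass d (point_cloud_varifold d \<Omega> \<K> x m P) (enlarge U (mesh_size \<K>) \<inter> \<Omega>))"
proof -
  interpret tagged_mesh d \<Omega> \<K> x m P
    using assms by unfold_locales auto
  show ?thesis
    unfolding bl_dist_def using assms by (intro SUP_least integral_gap_le)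
qed

end
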